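(* Let $D=\{(\mathbf{x}_i,\mathbf{s}_i,y_i)\}_{i=1}^{|D|}$ be a finite (ideal) dataset with labels $y_i\in\{y^1,\dots,y^C\}$ and spurious features $\mathbf{s}_i\in\{\mathbf{s}^1,\dots,\mathbf{s}^K\}$, let $f$ be a fixed classifier, and let $L_i=L(y_i,f(\mathbf{x}_i,\mathbf{s}_i))\in\mathbb{R}$ be the loss on the $i$-th sample. For each $i$ let $o_i\in\{0,1\}$ be a random variable (the observation indicator of sample $i$) such that $P(o_i=1)=p_{j,k}(o=1)$ whenever $y_i=y^j$ and $\mathbf{s}_i=\mathbf{s}^k$, where $p_{j,k}(o=1)\in(0,1]$ for all $j\in\{1,\dots,C\}$, $k\in\{1,\dots,K\}$. For positive numbers $\hat p(\mathbf{s}^k\mid y^j)$, define $$L_{IPW}=\frac{1}{|D|}\sum_{j=1}^{C}\sum_{k=1}^{K}\sum_{i=1}^{|D|}\frac{L_i\,\mathbb{I}_{\{y_i=y^j,\ \mathbf{s}_i=\mathbf{s}^k\}}\,\mathbb{I}_{\{o_i=1\}}}{K\,\hat p(\mathbf{s}^k\mid y^j)},$$ $$L_{ideal}=\frac{1}{|D|}\sum_{j=1}^{C}\sum_{k=1}^{K}\sum_{i=1}^{|D|}L_i\,\mathbb{I}_{\{y_i=y^j,\ \mathbf{s}_i=\mathbf{s}^k\}}.$$ If $\hat p(\mathbf{s}^k\mid y^j)=\dfrac{p_{j,k}(o=1)}{K}$ for all $j\in\{1,\dots,C\}$ and $k\in\{1,\dots,K\}$, then $\mathbb{E}[L_{I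PW}]=L_{ideal}$.
   Context: The dataset $D$ is fixed (deterministic), as are the classifier $f$, the losses $L_i$ and the numbers $\hat p(\mathbf{s}^k\mid y^j)$; the only randomness is in the observation indicators $o_i$, where $o_i=1$ means that sample $i$ of the ideal dataset appears in the observed dataset and $o_i=0$ that it does not. The expectation is over $(o_i)_i$. $\mathbb{I}_{\{A\}}$ equals $1$ if $A$ is true and $0$ otherwise. The values $y^1,\dots,y^C$ are pairwise distinct, and so are $\mathbf{s}^1,\dots,\mathbf{s}^K$. $p_{j,k}(o=1)$ denotes the probability that a sample with label $y^j$ and spurious feature $\mathbf{s}^k$ is observed. *)

theory Defs
  imports "HOL-Probability.Probability"
begin

datatype ('x, 's, 'y) sample = Sample (core: 'x) (spurious: 's) (label: 'y)

definition sample_loss ::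
  "('y \<Rightarrow> 'p \<Rightarrow> real) \<Rightarrow> ('x \<Rightarrow> 's \<Rightarrow> 'p) \<Rightarrow> ('x, 's, 'y) sample \<Rightarrow> real" where
  "sample_loss L f d = L (label d) (f (core d) (spurious d))"

(* The label values and spurious values are indexed from 1, i.e. ys 1, ..., ys C and
   ss 1, ..., ss K; the samples are the list entries D ! i with i < length D. *)

definition L_ideal ::
  "('y \<Rightarrow> 'p \<Rightarrow> real) \<Rightarrow> ('x \<Rightarrow> 's \<Rightarrow> 'p) \<Rightarrow> ('x, 's, 'y) sample list
    \<Rightarrow> nat \<Rightarrow> nat \<Rightarrow> (nat \<Rightarrow> 'y) \<Rightarrow> (nat \<Rightarrow> 's) \<Rightarrow> real" where
  "L_ideal L f D C K ys ss =
    1 / real (length D) *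
      (\<Sum>j\<in>{1..C}. \<Sum>k\<in>{1..K}. \<Sum>i<length D.
        sample_loss L f (D ! i)
          * of_bool (label (D ! i) = ys j \<and> spurious (D ! i) = ss k))"

(* phat s y stands for the number written phat(s | y); ob i is the realised value in {0, 1} of
   the observation indicator of sample i. *)

definition L_IPW ::
  "('y \<Rightarrow> 'p \<Rightarrow> real) \<Rightarrow> ('x \<Rightarrow> 's \<Rightarrow> 'p) \<Rightarrow> ('x, 's, 'y) sample list
    \<Rightarrow> nat \<Rightarrow> nat \<Rightarrow> (nat \<Rightarrow> 'y) \<Rightarrow> (nat \<Rightarrow> 's)
    \<Rightarrow> ('s \<Rightarrow> 'y \<Rightarrow> real) \<Rightarrow> (nat \<Rightarrow> nat) \<Rightarrow> real" where
  "L_IPW L f D C K ys ss phat ob =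
    1 / real (length D) *
      (\<Sum>j\<in>{1..C}. \<Sum>k\<in>{1..K}. \<Sum>i<length D.
        (sample_loss L f (D ! i)
          * of_bool (label (D ! i) = ys j \<and> spurious (D ! i) = ss k)
          * of_bool (ob i = 1))
        / (real K * phat (ss k) (ys j)))"

end

theory Submission
  imports Defs
begin

text \<open>Inverse probability weighting is unbiased term by term. In the cell (j, k), the
  assumption on \<open>phat\<close> turns the weight \<open>real K * phat (ss k) (ys j)\<close> into
  \<open>p j k\<close>, the observation probability of every sample of that cell. The indicator of
  observation has expectation \<open>p j k\<close> (\<open>has_bochner_integral_of_bool\<close>), so
  dividing by the weight leaves exactly the loss. Linearity of expectation then gives the equality,
  whatever the joint distribution of the indicators.\<close>

lemma (in finite_measure) has_bochner_integral_of_bool: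
  assumes "{w \<in> space M. P w} \<in> sets M"
  shows "has_bochner_integral M (\<lambda>w. of_bool (P w)) (\<P>(w in M. P w))"
proof -
  have "has_bochner_integral M (indicator {w \<in> space M. P w} :: _ \<Rightarrow> real) (\<P>(w in M. P w))"
    using assms by (intro has_bochner_integral_real_indicator) (auto simp: less_top[symmetric])
  \<comment> \<open>Outside \<open>space M\<close> the two functions may differ, but the integral
    only sees points of \<open>space M\<close>.\<close>
  moreover have "indicator {w \<in> space M. P w} w = (of_bool (P w) :: real)" if "w \<in> space M" for w
    using that by (simp add: indicator_def)
  ultimately show ?thesis
    by (simp cong: has_bochner_integral_cong)
qed

theorem mainTheorem1:
  fixes M :: "'w measure"
    and D :: "('x, 's, 'y) sample list"
    and C K :: nat
    and ys :: "nat \<Rightarrow> 'y" and ss :: "nat \<Rightarrow> 's"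
    and f :: "'x \<Rightarrow> 's \<Rightarrow> 'p"
    and L :: "'y \<Rightarrow> 'p \<Rightarrow> real"
    and ob :: "nat \<Rightarrow> 'w \<Rightarrow> nat"
    and p :: "nat \<Rightarrow> nat \<Rightarrow> real"
    and phat :: "'s \<Rightarrow> 'y \<Rightarrow> real"
  assumes "prob_space M"
    and "inj_on ys {1..C}" and "inj_on ss {1..K}"
    and "\<And>i. i < length D \<Longrightarrow> label (D ! i) \<in> ys ` {1..C}"
    and "\<And>i. i < length D \<Longrightarrow> spurious (D ! i) \<in> ss ` {1..K}"
    and "\<And>i. i < length D \<Longrightarrow> ob i \<in> measurable M (count_space {0, 1})"
    and "\<And>j k. j \<in> {1..C} \<Longrightarrow> k \<in> {1..K} \<Longrightarrow> 0 < p j k \<and> p j k \<le> 1"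
    and "\<And>i j k. i < length D \<Longrightarrow> j \<in> {1..C} \<Longrightarrow> k \<in> {1..K} \<Longrightarrow>
           label (D ! i) = ys j \<Longrightarrow> spurious (D ! i) = ss k \<Longrightarrow>
           \<P>(w in M. ob i w = 1) = p j k"
    and "\<And>j k. j \<in> {1..C} \<Longrightarrow> k \<in> {1..K} \<Longrightarrow> 0 < phat (ss k) (ys j)"
    and "\<And>j k. j \<in> {1..C} \<Longrightarrow> k \<in> {1..K} \<Longrightarrow> phat (ss k) (ys j) = p j k / real K"
  shows "(\<integral>w. L_IPW L f D C K ys ss phat (\<lambda>i. ob i w) \<partial>M) = L_ideal L f D C K ys ss"
proof -
  interpret prob_space M by fact
  \<comment> \<open>Unbiasedness of a single summand. \<open>has_bochner_integral\<close> records
    integrability together with the value, so the summands can later be added without separate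
    integrability proofs.\<close>
  have "has_bochner_integral M
      (\<lambda>w. sample_loss L f (D ! i)
          * of_bool (label (D ! i) = ys j \<and> spurious (D ! i) = ss k)
          * of_bool (ob i w = 1) / (real K * phat (ss k) (ys j)))
      (sample_loss L f (D ! i) * of_bool (label (D ! i) = ys j \<and> spurious (D ! i) = ss k))"
    if j: "j \<in> {1..C}" and k: "k \<in> {1..K}" and i: "i < length D" for i j k
  proof (cases "label (D ! i) = ys j \<and> spurious (D ! i) = ss k")
    case True
    have "{w \<in> space M. ob i w = 1} = ob i -` {1} \<inter> space M"
      by auto
    also have "\<dots> \<in> sets M"
      using assms(6)[OF i] by (rule measurable_sets) simp
    finally have "has_bochner_integral M (\<lambda>w. of_bool (ob i w = 1)) (\<P>(w in M. ob i w = 1))"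
      by (rule has_bochner_integral_of_bool)
    then have "has_bochner_integral M (\<lambda>w. of_bool (ob i w = 1)) (p j k)"
      using assms(8)[OF i j k] True by simp
    then have "has_bochner_integral M
        (\<lambda>w. sample_loss L f (D ! i) * of_bool (ob i w = 1) / p j k)
        (sample_loss L f (D ! i) * p j k / p j k)"
      by (intro has_bochner_integral_divide_zero has_bochner_integral_mult_right)
    \<comment> \<open>Positivity of \<open>p j k\<close> lets it cancel in the expectation;
      \<open>k \<in> {1..K}\<close> forces K to be nonzero, so K cancels in the weight.\<close>
    moreover have "p j k \<noteq> 0" "real K * phat (ss k) (ys j) = p j k"
      using assms(7,10)[OF j k] k by auto
    ultimately show ?thesis
      using True by simp
  next
    \<comment> \<open>Sample i lies outside the cell (j, k), so its observation probability need not
      be \<open>p j k\<close>; the summand is identically zero and so is its target.\<close>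
    case False
    then have "of_bool (label (D ! i) = ys j \<and> spurious (D ! i) = ss k) = (0::real)"
      by simp
    then show ?thesis
      by (simp only: mult_zero_left mult_zero_right div_0 has_bochner_integral_zero)
  qed
  \<comment> \<open>Linearity over the finite sums and the constant factor. For empty
    \<open>D\<close> that factor is 1 / 0 = 0 and both losses vanish.\<close>
  then have "has_bochner_integral M (\<lambda>w. L_IPW L f D C K ys ss phat (\<lambda>i. ob i w))
      (L_ideal L f D C K ys ss)"
    unfolding L_IPW_def L_ideal_def
    by (intro has_bochner_integral_mult_right has_bochner_integral_sum) auto
  then show ?thesis
    by (rule has_bochner_integral_integral_eq)
qed

end
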